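(* Let $v_1\ge3$ and $v_2\ge1$ be integers, $\mathbf{v}=(v_1,v_2)$ and $\mathbf{k}=(3,1)$. If there exists a strong Kirkman signal set $\mathrm{SKSS}(v_1)$, then there exists a $2$-$(\mathbf{v},\mathbf{k},1)$ generalized packing with $\min\{D(v_1,3,2),\ v_2\lfloor v_1/3\rfloor\}$ blocks.
   Context: Let $X_1,X_2$ be disjoint sets with $|X_1|=v_1$, $|X_2|=v_2$. A block is a pair $(B,\{x\})$ with $B$ a $3$-subset of $X_1$ and $x\in X_2$. A $2$-$((v_1,v_2),(3,1),1)$ generalized packing is a family of blocks such that no $2$-subset of $X_1$ is contained in the first coordinate of more than one block, and for each $a\in X_1$, $x\in X_2$ at most one block $(B,\{x\})$ has $a\in B$. $D(v_1,3,2)$ is the maximum number of $3$-subsets of a $v_1$-set such that every $2$-subset lies in at most one of them (a maximum $2$-$(v_1,3,1)$ packing). A strong Kirkman signal set $\mathrm{SKSS}(v_1)$ is a maximum $2$-$(v_1,3,1)$ packing (with $D(v_1,3,2)$ blocks) whose blocks are partitioned into $s$ classes of size $m=\lfloor v_1/3\rfloor$ and one further class of size $r$, where $D(v_1,3,2)=sm+r$ and $0\le r<m$, such that within each class the blocks are pairwise disjoint. *)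

theory Defs
  imports Main "HOL-Library.Disjoint_Sets"
begin

text \<open>
  A \<open>t\<close>-\<open>(v,k,1)\<close> packing on the point set \<open>X\<close> (with \<open>v = card X\<close>). Since \<open>\<lambda> = 1\<close> and \<open>t \<le> k\<close>,
  a packing cannot have repeated blocks, so a set of blocks loses nothing.
\<close>

definition packing :: "nat \<Rightarrow> nat \<Rightarrow> 'a set \<Rightarrow> 'a set set \<Rightarrow> bool" where
  "packing t k X F \<longleftrightarrow>
     finite X \<and>
     (\<forall>B\<in>F. B \<subseteq> X \<and> card B = k) \<and>
     (\<forall>T. T \<subseteq> X \<and> card T = t \<longrightarrow> card {B\<in>F. T \<subseteq> B} \<le> 1)"

definition packing_number :: "nat \<Rightarrow> nat \<Rightarrow> nat \<Rightarrow> nat" where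
  "packing_number v k t = Max {card F | F. packing t k {..<v} F}"

text \<open>
  The classes are indexed by \<open>{..s}\<close> rather than collected in a set, because the last class
  \<open>C s\<close>, of size \<open>r\<close>, may be empty.
\<close>

definition strong_kirkman_signal_set :: "nat \<Rightarrow> 'a set \<Rightarrow> 'a set set \<Rightarrow> bool" where
  "strong_kirkman_signal_set v X F \<longleftrightarrow>
     finite X \<and> card X = v \<and>
     packing 2 3 X F \<and> card F = packing_number v 3 2 \<and>
     (\<exists>s r C. packing_number v 3 2 = s * (v div 3) + r \<and> r < v div 3 \<and>
        (\<Union>i\<le>s. C i) = F \<and> disjoint_family_on C {..s} \<and>
        (\<forall>i<s. card (C i) = v div 3) \<and> card (C s) = r \<and>
        (\<forall>i\<le>s. pairwise disjnt (C i)))"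

text \<open>
  A \<open>2\<close>-\<open>((v\<^sub>1,v\<^sub>2),(3,1),1)\<close> generalized packing on the disjoint point sets \<open>X\<^sub>1\<close>, \<open>X\<^sub>2\<close>.
  As above, a repeated block would violate the condition on 2-subsets of \<open>X\<^sub>1\<close>, so families of
  blocks are sets.
\<close>

definition generalized_packing ::
    "nat \<Rightarrow> nat \<Rightarrow> 'a set \<Rightarrow> 'a set \<Rightarrow> ('a set \<times> 'a set) set \<Rightarrow> bool" where
  "generalized_packing v1 v2 X1 X2 P \<longleftrightarrow>
     finite X1 \<and> card X1 = v1 \<and> finite X2 \<and> card X2 = v2 \<and> X1 \<inter> X2 = {} \<and>
     P \<subseteq> {(B, {x}) | B x. B \<subseteq> X1 \<and> card B = 3 \<and> x \<in> X2} \<and>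
     (\<forall>T. T \<subseteq> X1 \<and> card T = 2 \<longrightarrow> card {b\<in>P. T \<subseteq> fst b} \<le> 1) \<and>
     (\<forall>a\<in>X1. \<forall>x\<in>X2. card {b\<in>P. a \<in> fst b \<and> snd b = {x}} \<le> 1)"

end

theory Submission
  imports Defs
begin

text \<open>Blocks in one class are disjoint, so giving a whole class the same point
  \<open>x\<close> puts each \<open>a\<close> of \<open>X1\<close> in at most one block with
  \<open>x\<close>. Pairs inside \<open>X1\<close> stay covered at most once, because the signal set
  is a packing. This is \<open>generalized_packing_of_coloured_packing\<close>, which also carries
  the blocks from \<open>Y\<close> to \<open>X1\<close>. The size comes from
  \<open>card_UN_initial_classes\<close>: since the short class comes last, either only full classes
  are used or all blocks are.\<close>

text \<open>
  Attach a different point of \<open>X\<^sub>2\<close> to each class of the signal set, starting with the classes of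
  full size, until either the points or the classes run out.
\<close>

lemma packing_finite: "packing t k X F \<Longrightarrow> finite F"
  unfolding packing_def by (meson PowI finite_Pow_iff finite_subset subsetI)

lemma packing_block_unique:
  assumes "packing t k X F" "B \<in> F" "B' \<in> F" "T \<subseteq> B" "T \<subseteq> B'" "card T = t"
  shows "B = B'"
proof -
  \<comment> \<open>An infinite set has \<open>card\<close> 0, so uniqueness needs finiteness
    besides the bound.\<close>
  have "finite {B \<in> F. T \<subseteq> B}"
    using packing_finite[OF assms(1)] by simp
  moreover have "card {B \<in> F. T \<subseteq> B} \<le> Suc 0"
    using assms unfolding packing_def by (metis One_nat_def order_trans)
  ultimately show ?thesis
    using assms by (auto simp: card_le_Suc0_iff_eq)
qed

text \<open>Reduces both counting conditions of \<open>generalized_packing\<close> to uniqueness of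
  a block before it is mapped.\<close>

lemma card_filter_image_le_1:
  assumes "finite A"
    and "\<And>x y. x \<in> A \<Longrightarrow> y \<in> A \<Longrightarrow> Q (\<phi> x) \<Longrightarrow> Q (\<phi> y) \<Longrightarrow> x = y"
  shows "card {b \<in> \<phi> ` A. Q b} \<le> 1"
proof -
  have "{b \<in> \<phi> ` A. Q b} = \<phi> ` {x \<in> A. Q (\<phi> x)}"
    by auto
  moreover have "card {x \<in> A. Q (\<phi> x)} \<le> 1"
    using assms by (simp add: card_le_Suc0_iff_eq)
  ultimately show ?thesis
    using card_image_le[of "{x \<in> A. Q (\<phi> x)}" \<phi>] assms(1) by simp
qed

text \<open>If \<open>n \<le> s\<close>, only full classes are counted and \<open>n * m\<close> is
  the smaller term. Otherwise every class is counted, and \<open>r < m\<close> gives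
  \<open>s * m + r < Suc s * m \<le> n * m\<close>.\<close>

lemma card_UN_initial_classes:
  fixes C :: "nat \<Rightarrow> 'a set"
  assumes fin: "finite (\<Union>i\<le>s. C i)" and disj: "disjoint_family_on C {..s}"
    and full: "\<And>i. i < s \<Longrightarrow> card (C i) = m" and last: "card (C s) = r" and "r < m"
  shows "card (\<Union>i<min n (Suc s). C i) = min (s * m + r) (n * m)"
proof -
  have "card (\<Union>i<min n (Suc s). C i) = (\<Sum>i<min n (Suc s). card (C i))"
  proof (rule card_UN_disjoint')
    show "disjoint_family_on C {..<min n (Suc s)}"
      using disj by (rule disjoint_family_on_mono[rotated]) auto
    show "finite (C i)" if "i \<in> {..<min n (Suc s)}" for i
      using that by (intro finite_subset[OF _ fin]) force
  qed simp
  also have "\<dots> = min (s * m + r) (n * m)"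
  proof (cases "n \<le> s")
    case True
    then have "n * m \<le> s * m + r"
      by (simp add: trans_le_add1)
    with True full show ?thesis
      by simp
  next
    case False
    then have "Suc s * m \<le> n * m"
      by (intro mult_right_mono) auto
    with \<open>r < m\<close> have "min (s * m + r) (n * m) = s * m + r"
      by simp
    moreover have "min n (Suc s) = Suc s"
      using False by simp
    ultimately show ?thesis
      using full last by simp
  qed
  finally show ?thesis .
qed

text \<open>Here \<open>h\<close> colours blocks by points of \<open>X2\<close> so that distinct
  blocks of equal colour are disjoint. The injectivity of \<open>f\<close> on \<open>Y\<close> lets
  each intersection or inclusion in \<open>X1\<close> be pulled back to \<open>Y\<close>.\<close>

lemma generalized_packing_of_coloured_packing:
  assumes "finite X1" "card X1 = v1" "finite X2" "card X2 = v2" "X1 \<inter> X2 = {}"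
    and f: "bij_betw f Y X1"
    and pack: "packing 2 3 Y F" and "G \<subseteq> F"
    and col: "\<And>B. B \<in> G \<Longrightarrow> h B \<in> X2"
    and disj: "\<And>B B'. B \<in> G \<Longrightarrow> B' \<in> G \<Longrightarrow> h B = h B' \<Longrightarrow> B \<inter> B' \<noteq> {} \<Longrightarrow> B = B'"
  shows "\<exists>P. generalized_packing v1 v2 X1 X2 P \<and> card P = card G"
proof -
  define P where "P = (\<lambda>B. (f ` B, {h B})) ` G"
  have block: "B \<subseteq> Y" "card B = 3" if "B \<in> G" for B
    using pack that \<open>G \<subseteq> F\<close> unfolding packing_def by auto
  have inj: "inj_on f Y" and img: "f ` Y = X1"
    using f by (auto simp: bij_betw_def)
  have finG: "finite G"
    using \<open>G \<subseteq> F\<close> packing_finite[OF pack] by (rule finite_subset)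
  \<comment> \<open>The first coordinate alone determines \<open>B\<close>.\<close>
  have "inj_on (\<lambda>B. (f ` B, {h B})) G"
    using inj block by (auto intro!: inj_onI simp: inj_on_image_eq_iff)
  then have card_P: "card P = card G"
    unfolding P_def by (rule card_image)
  have "P \<subseteq> {(B, {x}) | B x. B \<subseteq> X1 \<and> card B = 3 \<and> x \<in> X2}"
  proof -
    have "f ` B \<subseteq> X1 \<and> card (f ` B) = 3" if "B \<in> G" for B
      using block[OF that] inj img by (metis card_image image_mono inj_on_subset)
    then show ?thesis
      unfolding P_def using col by auto
  qed
  moreover have "card {b \<in> P. T \<subseteq> fst b} \<le> 1" if T: "T \<subseteq> X1" "card T = 2" for T
  proof -
    obtain T' where T': "T' \<subseteq> Y" "T = f ` T'"
      using T(1) img by (metis subset_image_iff)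
    have card_T': "card T' = 2"
      using T(2) T' inj by (metis card_image inj_on_subset)
    have sub: "T' \<subseteq> B" if "B \<in> G" "T \<subseteq> f ` B" for B
    proof
      fix y assume "y \<in> T'"
      then have "y \<in> Y" "f y \<in> f ` B"
        using T' that(2) by auto
      then show "y \<in> B"
        using inj_on_image_mem_iff[OF inj] block(1)[OF that(1)] by blast
    qed
    have "B = B'" if "B \<in> G" "B' \<in> G" "T \<subseteq> f ` B" "T \<subseteq> f ` B'" for B B'
      using that \<open>G \<subseteq> F\<close> by (intro packing_block_unique[OF pack _ _ sub sub card_T']) auto
    then show ?thesis
      unfolding P_def by (intro card_filter_image_le_1[OF finG]) simp
  qed
  moreover have "card {b \<in> P. a \<in> fst b \<and> snd b = {x}} \<le> 1" for a x
  proof -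
    have "B = B'" if "B \<in> G" "B' \<in> G" "a \<in> f ` B" "a \<in> f ` B'" "h B = h B'" for B B'
    proof -
      \<comment> \<open>The shared image point \<open>a\<close> thus comes from a shared point of
        \<open>B\<close> and \<open>B'\<close>.\<close>
      have "f ` (B \<inter> B') = f ` B \<inter> f ` B'"
        using inj block that(1,2) by (intro inj_on_image_Int) auto
      then have "B \<inter> B' \<noteq> {}"
        using that(3,4) by blast
      then show ?thesis
        by (rule disj[OF that(1,2,5)])
    qed
    then show ?thesis
      unfolding P_def by (intro card_filter_image_le_1[OF finG]) simp
  qed
  ultimately have "generalized_packing v1 v2 X1 X2 P"
    unfolding generalized_packing_def using assms(1-5) by simp
  with card_P show ?thesis
    by blast
qed

theorem theorem5p4:
  fixes v1 v2 :: nat and X1 X2 :: "'a set"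
  assumes "v1 \<ge> 3" and "v2 \<ge> 1"
    and "finite X1" and "card X1 = v1"
    and "finite X2" and "card X2 = v2"
    and "X1 \<inter> X2 = {}"
    and "\<exists>(Y :: 'b set) F. strong_kirkman_signal_set v1 Y F"
  shows "\<exists>P. generalized_packing v1 v2 X1 X2 P \<and>
             card P = min (packing_number v1 3 2) (v2 * (v1 div 3))"
proof -
  obtain Y :: "'b set" and F s r C where Y: "finite Y" "card Y = v1" and pack: "packing 2 3 Y F"
    and D: "packing_number v1 3 2 = s * (v1 div 3) + r" "r < v1 div 3"
    and F: "(\<Union>i\<le>s. C i) = F" and disj: "disjoint_family_on C {..s}"
    and card_C: "\<And>i. i < s \<Longrightarrow> card (C i) = v1 div 3" "card (C s) = r"
    and C: "\<And>i. i \<le> s \<Longrightarrow> pairwise disjnt (C i)"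
    using assms(8) unfolding strong_kirkman_signal_set_def by blast
  obtain f where f: "bij_betw f Y X1"
    using Y assms(3,4) finite_same_card_bij by metis
  obtain g where g: "bij_betw g {..<v2} X2"
    using assms(5,6) by (metis card_lessThan finite_lessThan finite_same_card_bij)
  \<comment> \<open>There are \<open>Suc s\<close> classes, and the short class \<open>C s\<close>
    is used only if \<open>v2 > s\<close>.\<close>
  define n where "n = min v2 (Suc s)"
  define G where "G = (\<Union>i<n. C i)"
  have "\<forall>B\<in>G. \<exists>i<n. B \<in> C i"
    unfolding G_def by blast
  then obtain c where c: "\<And>B. B \<in> G \<Longrightarrow> c B < n" "\<And>B. B \<in> G \<Longrightarrow> B \<in> C (c B)"
    by metis
  have "G \<subseteq> F"
    unfolding G_def n_def F[symmetric] by (intro UN_mono) auto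
  have col: "g (c B) \<in> X2" if "B \<in> G" for B
    using c(1)[OF that] bij_betwE[OF g] by (simp add: n_def)
  have col_disj: "B = B'" if "B \<in> G" "B' \<in> G" "g (c B) = g (c B')" "B \<inter> B' \<noteq> {}" for B B'
  proof -
    \<comment> \<open>Class indices are below \<open>n \<le> v2\<close>, where \<open>g\<close> is
      injective, so equal colours mean the same class.\<close>
    have "c B = c B'"
      using that c(1) g by (auto simp: n_def bij_betw_def dest: inj_onD)
    then have "B \<in> C (c B)" "B' \<in> C (c B)" "c B \<le> s"
      using that c[of B] c[of B'] by (auto simp: n_def)
    with C that(4) show ?thesis
      by (metis disjnt_def pairwiseD)
  qed
  have card_G: "card G = min (packing_number v1 3 2) (v2 * (v1 div 3))"
    unfolding G_def n_def D(1)
    using packing_finite[OF pack] F disj card_C D(2) by (intro card_UN_initial_classes) auto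
  show ?thesis
    unfolding card_G[symmetric]
    by (rule generalized_packing_of_coloured_packing[where h = "\<lambda>B. g (c B)",
          OF assms(3-7) f pack \<open>G \<subseteq> F\<close>]) (fact col, fact col_disj)
qed

end
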